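(* Let $k$ be a positive integer and let $b_1,\ldots,b_k$ be nonzero complex numbers such that no $b_i$ lies in $\{q^j : j\in\mathbb{Z}\}$ and the numbers $b_1+b_1^{-1},\ldots,b_k+b_k^{-1}$ are pairwise distinct. Then \[ \sum_{m_1,\ldots,m_{k-1}=0}^\infty \frac{(b_2,b_2^{-1};q)_{m_1} (b_3,b_3^{-1};q)_{m_1+m_2}\cdots (b_k,b_k^{-1};q)_{m_1+\cdots+ m_{k-1}}\, q^{\sum_{i=1}^{k-1}(k-i)m_i}} {(qb_1,qb_1^{-1};q)_{m_1} (qb_2,qb_2^{-1};q)_{m_1+m_2}\cdots (qb_{k-1},qb_{k-1}^{-1};q)_{m_1+\cdots+ m_{k-1}}} \] \[ = (qb_k,q/b_k;q)_\infty \prod_{i=1}^k(1-b_i)(1-b_i^{-1}) \sum_{i=1}^k \frac{A_{k,i}(b_1,\ldots,b_k)}{(b_i,b_i^{-1};q)_\infty}, \] where the functions $A_{k,i}$ ($1\le i\le k$) are defined recursively by $A_{1,1}(b_1)=1$ and, for $k\ge 2$, \[ A_{k,i}(b_1,\ldots,b_k) =\begin{cases} C(b_k,b_{k-1})\, A_{k-1,k-1}(b_1,\ldots,b_{k-2},b_{k}) & \text{if $i=k$,} \\ -C(b_k,b_{k-1})\, A_{k-1,k-1}(b_1,\ldots,b_{k-1}) & \text{if $i=k-1$,} \\ C(b_k,b_{k-1}) \Big( A_{k-1,i}(b_1,\ldots,b_{k-2},b_{k}) -A_{k-1,i}(b_1,\ldots,b_{k-1})\Big) & \text{if $1\leq i\leq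 k-2$.} \end{cases} \]
   Context: $q$ is a complex number with $|q|<1$. Notation: $(a;q)_0=1$, $(a;q)_n=\prod_{j=0}^{n-1}(1-aq^j)$, $(a;q)_\infty=\prod_{j\ge0}(1-aq^j)$, and $(a_1,\ldots,a_r;q)_n=\prod_{j=1}^r(a_j;q)_n$ (also for $n=\infty$). For complex $y,z$ with $z+z^{-1}\neq y+y^{-1}$, $C(z,y):=\frac{1}{z+z^{-1}-y-y^{-1}}$. For $k=1$ the left-hand side is an empty multiple sum and equals $1$. *)

theory Defs
  imports "HOL-Analysis.Analysis"
begin

definition qpoch :: "complex \<Rightarrow> complex \<Rightarrow> nat \<Rightarrow> complex" where
  "qpoch a q n = (\<Prod>j<n. 1 - a * q ^ j)"

definition qpoch_inf :: "complex \<Rightarrow> complex \<Rightarrow> complex" where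
  "qpoch_inf a q = (\<Prod>j. 1 - a * q ^ j)"

definition qpochs :: "complex list \<Rightarrow> complex \<Rightarrow> nat \<Rightarrow> complex" where
  "qpochs as q n = (\<Prod>a\<leftarrow>as. qpoch a q n)"

definition qpochs_inf :: "complex list \<Rightarrow> complex \<Rightarrow> complex" where
  "qpochs_inf as q = (\<Prod>a\<leftarrow>as. qpoch_inf a q)"

definition C :: "complex \<Rightarrow> complex \<Rightarrow> complex" where
  "C z y = 1 / (z + inverse z - y - inverse y)"

text \<open>
  The parameters are given by a function \<open>b\<close> of which \<open>A k i b\<close> reads only the values
  \<open>b 1, \<dots>, b k\<close>. Updating \<open>b\<close> at \<open>k - 1\<close> to \<open>b k\<close> therefore yields, for \<open>A (k - 1)\<close>, the
  argument list \<open>b 1, \<dots>, b (k - 2), b k\<close>. The value is \<open>0\<close> unless \<open>1 \<le> i \<le> k\<close>.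
\<close>

fun A :: "nat \<Rightarrow> nat \<Rightarrow> (nat \<Rightarrow> complex) \<Rightarrow> complex" where
  "A 0 i b = 0"
| "A (Suc 0) i b = (if i = 1 then 1 else 0)"
| "A (Suc (Suc n)) i b =
    (let k = Suc (Suc n) in
     if i = k then C (b k) (b (k - 1)) * A (Suc n) (k - 1) (b(k - 1 := b k))
     else if i = k - 1 then - C (b k) (b (k - 1)) * A (Suc n) (k - 1) b
     else if 1 \<le> i \<and> i \<le> k - 2 then
       C (b k) (b (k - 1)) * (A (Suc n) i (b(k - 1 := b k)) - A (Suc n) i b)
     else 0)"

definition multi_term :: "complex \<Rightarrow> nat \<Rightarrow> (nat \<Rightarrow> complex) \<Rightarrow> (nat \<Rightarrow> nat) \<Rightarrow> complex" where
  "multi_term q k b m =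
    (\<Prod>j=1..<k. qpochs [b (j + 1), inverse (b (j + 1))] q (\<Sum>i=1..j. m i))
      * q ^ (\<Sum>i=1..<k. (k - i) * m i)
    / (\<Prod>j=1..<k. qpochs [q * b j, q * inverse (b j)] q (\<Sum>i=1..j. m i))"

end

theory Submission
  imports Defs
begin

text \<open>
  In terms of the partial sums \<open>M\<^sub>j = m\<^sub>1 + \<dots> + m\<^sub>j\<close> the summand is a product of factors
  \<open>q^M (b\<^sub>j\<^sub>+\<^sub>1, 1/b\<^sub>j\<^sub>+\<^sub>1; q)\<^sub>M / (q b\<^sub>j, q/b\<^sub>j; q)\<^sub>M\<close> at \<open>M = M\<^sub>j\<close>, and each such factor is, up to a
  constant, the difference of \<open>t M = (b\<^sub>j\<^sub>+\<^sub>1, 1/b\<^sub>j\<^sub>+\<^sub>1; q)\<^sub>M / (b\<^sub>j, 1/b\<^sub>j; q)\<^sub>M\<close> at \<open>M + 1\<close> and \<open>M\<close>.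
  Hence the innermost sum telescopes; its value at infinity leaves the sum for
  \<open>b\<^sub>1, \<dots>, b\<^sub>k\<close>, and its value at the lower end leaves the sum in which \<open>b\<^sub>k\<close> is
  replaced by \<open>b\<^sub>k\<^sub>+\<^sub>1\<close>. After division by \<open>(b\<^sub>k, 1/b\<^sub>k; q)\<^sub>\<infinity>\<close> this is the divided difference
  recursion that defines \<open>A\<close>.
\<close>

section \<open>Finite and infinite products (b, 1/b; q), their limits and their zeros\<close>

abbreviation sym_qpoch :: "complex \<Rightarrow> complex \<Rightarrow> nat \<Rightarrow> complex" where
  "sym_qpoch q b \<equiv> qpochs [b, inverse b] q"

abbreviation sym_qpoch_inf :: "complex \<Rightarrow> complex \<Rightarrow> complex" where
  "sym_qpoch_inf q b \<equiv> qpochs_inf [b, inverse b] q"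

lemma qpoch_Suc_shift: "qpoch a q (Suc n) = (1 - a) * qpoch (q * a) q n"
  by (simp add: qpoch_def prod.lessThan_Suc_shift mult_ac del: prod.lessThan_Suc)

text \<open>Pairing the factors for b and 1/b makes the new factor depend on b only through b + 1/b,
  and linearly so; the telescoping rests on this.\<close>

lemma sym_qpoch_Suc:
  assumes "b \<noteq> 0"
  shows "sym_qpoch q b (Suc n) = sym_qpoch q b n * (1 - (b + inverse b) * q ^ n + q ^ n * q ^ n)"
  using assms by (simp add: qpochs_def qpoch_def field_simps)

lemma sym_qpoch_Suc_shift:
  "sym_qpoch q b (Suc n) = (1 - b) * (1 - inverse b) * qpochs [q * b, q * inverse b] q n"
  by (simp add: qpochs_def qpoch_Suc_shift)

lemma convergent_prod_qpoch:
  fixes a q :: complex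
  assumes "norm q < 1"
  shows "convergent_prod (\<lambda>j. 1 - a * q ^ j)"
proof (intro abs_convergent_prod_imp_convergent_prod summable_imp_abs_convergent_prod)
  have "summable (\<lambda>j. norm a * norm q ^ j)"
    using assms by (intro summable_mult summable_geometric) auto
  then show "summable (\<lambda>j. norm (1 - a * q ^ j - 1))"
    by (simp add: norm_mult norm_power)
qed

lemma qpoch_tendsto:
  assumes "norm q < 1"
  shows "qpoch a q \<longlonglongrightarrow> qpoch_inf a q"
  using convergent_prod_LIMSEQ[OF convergent_prod_qpoch[OF assms, of a]]
  by (simp add: qpoch_def[abs_def] qpoch_inf_def LIMSEQ_lessThan_iff_atMost)

lemma sym_qpoch_tendsto:
  assumes "norm q < 1"
  shows "sym_qpoch q b \<longlonglongrightarrow> sym_qpoch_inf q b"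
  unfolding qpochs_def[abs_def] qpochs_inf_def
  using tendsto_mult[OF qpoch_tendsto[OF assms, of b] qpoch_tendsto[OF assms, of "inverse b"]]
  by simp

lemma qpoch_inf_shift:
  assumes "norm q < 1"
  shows "qpoch_inf a q = (1 - a) * qpoch_inf (q * a) q"
proof -
  have "(\<lambda>n. qpoch a q (Suc n)) \<longlonglongrightarrow> qpoch_inf a q"
    using qpoch_tendsto[OF assms] by (rule LIMSEQ_Suc)
  moreover have "(\<lambda>n. qpoch a q (Suc n)) \<longlonglongrightarrow> (1 - a) * qpoch_inf (q * a) q"
    unfolding qpoch_Suc_shift by (intro tendsto_intros qpoch_tendsto assms)
  ultimately show ?thesis by (rule LIMSEQ_unique)
qed

lemma sym_qpoch_inf_shift:
  assumes "norm q < 1"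
  shows "sym_qpoch_inf q b = (1 - b) * (1 - inverse b) * qpochs_inf [q * b, q / b] q"
  using qpoch_inf_shift[OF assms, of b] qpoch_inf_shift[OF assms, of "inverse b"]
  by (simp add: qpochs_inf_def divide_inverse)

text \<open>A vanishing factor would make b equal to q^(-n) or to q^n, both excluded as integer
  powers of q.\<close>

lemma sym_qpoch_factors_nonzero:
  fixes b q :: complex
  assumes "b \<noteq> 0" "b \<notin> range (\<lambda>j::int. q powi j)"
  shows "1 - b * q ^ n \<noteq> 0" "1 - inverse b * q ^ n \<noteq> 0"
proof -
  have pow: "b \<noteq> q ^ n" and inv: "b \<noteq> inverse (q ^ n)"
    using assms(2) rangeI[of "\<lambda>j::int. q powi j" "int n"]
      rangeI[of "\<lambda>j::int. q powi j" "- int n"]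
    by (auto simp: power_int_minus)
  from inv show "1 - b * q ^ n \<noteq> 0"
    by (metis eq_iff_diff_eq_0 inverse_unique mult.commute)
  from pow assms(1) show "1 - inverse b * q ^ n \<noteq> 0"
    by (auto simp: field_simps)
qed

lemma sym_qpoch_nonzero:
  assumes "b \<noteq> 0" "b \<notin> range (\<lambda>j::int. q powi j)"
  shows "sym_qpoch q b n \<noteq> 0"
  using sym_qpoch_factors_nonzero[OF assms] by (simp add: qpochs_def qpoch_def)

lemma sym_qpoch_inf_nonzero:
  assumes "norm q < 1" "b \<noteq> 0" "b \<notin> range (\<lambda>j::int. q powi j)"
  shows "sym_qpoch_inf q b \<noteq> 0"
  using sym_qpoch_factors_nonzero[OF assms(2,3)]
  by (simp add: qpochs_inf_def qpoch_inf_def prodinf_nonzero convergent_prod_qpoch assms(1))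

section \<open>The factor contributed by a single partial sum, and its telescoping\<close>

text \<open>With b = b_j and c = b_(j+1) this is the part of the summand that depends on M_j = n.
  The power q^n is its share of the total, since the sum of (k - i) m_i equals M_1 + ... +
  M_(k-1).\<close>

definition step_ratio :: "complex \<Rightarrow> complex \<Rightarrow> complex \<Rightarrow> nat \<Rightarrow> complex" where
  "step_ratio q b c n = sym_qpoch q c n * q ^ n / qpochs [q * b, q * inverse b] q n"

text \<open>With Q = q^n, the factors that take \<open>n\<close> to \<open>Suc n\<close> are 1 - yQ
  + Q^2 for c and 1 - xQ + Q^2 for b. They differ by a multiple of Q alone, which supplies the power
  q^n of the summand.\<close>

lemma step_ratio_telescope:
  assumes "b \<noteq> 0" "b \<notin> range (\<lambda>j::int. q powi j)" "c \<noteq> 0"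
    and "b + inverse b \<noteq> c + inverse c"
  shows "step_ratio q b c n = - ((1 - b) * (1 - inverse b) * C c b) *
    (sym_qpoch q c (Suc n) / sym_qpoch q b (Suc n) - sym_qpoch q c n / sym_qpoch q b n)"
proof -
  define x y Q where "x = b + inverse b" and "y = c + inverse c" and "Q = q ^ n"
  define P R w where "P = sym_qpoch q c n" and "R = sym_qpoch q b n"
    and "w = 1 - x * Q + Q * Q"
  have b: "sym_qpoch q b (Suc n) = R * w" and c: "sym_qpoch q c (Suc n) = P * (1 - y * Q + Q * Q)"
    using sym_qpoch_Suc assms by (simp_all add: x_def y_def Q_def P_def R_def w_def)
  have R: "R \<noteq> 0" and Rw: "R * w \<noteq> 0"
    using sym_qpoch_nonzero[OF assms(1,2)] b by (metis R_def)+
  have xy: "y - x \<noteq> 0" using assms(4) by (simp add: x_def y_def)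
  have C: "C c b = 1 / (y - x)" by (simp add: C_def x_def y_def algebra_simps)
  define u where "u = (1 - b) * (1 - inverse b)"
  have u: "u * qpochs [q * b, q * inverse b] q n = R * w"
    using b sym_qpoch_Suc_shift[of b q n] by (simp add: u_def)
  with Rw have "u \<noteq> 0" by auto
  with u have "qpochs [q * b, q * inverse b] q n = R * w / u"
    by (metis nonzero_mult_div_cancel_left)
  then have "step_ratio q b c n = u * (P * Q / (R * w))"
    by (simp add: step_ratio_def P_def Q_def)
  also have "P * Q / (R * w) = - (1 / (y - x)) * (P * (1 - y * Q + Q * Q) / (R * w) - P / R)"
  proof -
    have "P * (1 - y * Q + Q * Q) / (R * w) - P / R = P * (1 - y * Q + Q * Q - w) / (R * w)"
      using R Rw by (simp add: field_simps)
    also have "1 - y * Q + Q * Q - w = - (y - x) * Q"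
      by (simp add: w_def algebra_simps)
    finally have diff: "P * (1 - y * Q + Q * Q) / (R * w) - P / R = - (y - x) * (P * Q / (R * w))"
      by simp
    have "Z = - (1 / d) * (- d * Z)" if "d \<noteq> 0" for d Z :: complex
      using that by simp
    from this[OF xy] show ?thesis unfolding diff .
  qed
  finally show ?thesis
    by (simp add: b c C u_def flip: P_def R_def)
qed

text \<open>The cofactor of q^n converges, hence is bounded. The geometric decay gives absolute
  convergence here and for the multiple sum.\<close>

lemma step_ratio_bound:
  assumes "norm q < 1" "b \<noteq> 0" "b \<notin> range (\<lambda>j::int. q powi j)"
  obtains K where "\<And>n. norm (step_ratio q b c n) \<le> K * norm q ^ n"
proof -
  let ?u = "(1 - b) * (1 - inverse b)"
  let ?t = "\<lambda>n. ?u * sym_qpoch q c n / sym_qpoch q b (Suc n)"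
  have "?t \<longlonglongrightarrow> ?u * sym_qpoch_inf q c / sym_qpoch_inf q b"
    by (intro tendsto_intros LIMSEQ_Suc sym_qpoch_tendsto sym_qpoch_inf_nonzero assms)
  then have "Bseq ?t" by (blast intro: convergentI convergent_imp_Bseq)
  then obtain K where K: "\<And>n. norm (?t n) \<le> K" by (auto simp: Bseq_def)
  \<comment> \<open>At length one the product (b, 1/b; q) is \<open>?u\<close> itself.\<close>
  have "?u \<noteq> 0"
    using sym_qpoch_nonzero[OF assms(2,3), of "Suc 0"] sym_qpoch_Suc_shift[of b q 0] by auto
  then have "step_ratio q b c n = ?t n * q ^ n" for n
    unfolding sym_qpoch_Suc_shift step_ratio_def by simp
  then have "norm (step_ratio q b c n) = norm (?t n) * norm q ^ n" for n
    by (metis norm_mult norm_power)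
  then have "norm (step_ratio q b c n) \<le> K * norm q ^ n" for n
    using mult_right_mono[OF K, of "norm q ^ n" n] by simp
  then show ?thesis by (rule that)
qed

text \<open>The sum telescopes to its lower end minus its limit. The offset \<open>N\<close> stands
  for the sum of the outer indices.\<close>

lemma step_ratio_tail_has_sum:
  assumes "norm q < 1" "b \<noteq> 0" "b \<notin> range (\<lambda>j::int. q powi j)" "c \<noteq> 0"
    and "b + inverse b \<noteq> c + inverse c"
  shows "((\<lambda>n. step_ratio q b c (N + n)) has_sum (1 - b) * (1 - inverse b) * C c b *
    (sym_qpoch q c N / sym_qpoch q b N - sym_qpoch_inf q c / sym_qpoch_inf q b)) UNIV"
proof (rule norm_summable_imp_has_sum)
  obtain K where K: "\<And>n. norm (step_ratio q b c n) \<le> K * norm q ^ n"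
    using step_ratio_bound[OF assms(1-3)] by blast
  have "summable (\<lambda>n. norm (step_ratio q b c n))"
  proof (rule summable_comparison_test')
    show "summable (\<lambda>n. K * norm q ^ n)"
      using assms(1) by (intro summable_mult summable_geometric) auto
  qed (use K in auto)
  then show "summable (\<lambda>n. norm (step_ratio q b c (N + n)))"
    using summable_iff_shift[of "\<lambda>n. norm (step_ratio q b c n)" N] by (simp add: add.commute)
next
  let ?t = "\<lambda>n. sym_qpoch q c n / sym_qpoch q b n"
  have "?t \<longlonglongrightarrow> sym_qpoch_inf q c / sym_qpoch_inf q b"
    by (intro tendsto_intros sym_qpoch_tendsto sym_qpoch_inf_nonzero assms)
  then have "(\<lambda>n. ?t (n + N)) \<longlonglongrightarrow> sym_qpoch_inf q c / sym_qpoch_inf q b"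
    by (rule LIMSEQ_ignore_initial_segment)
  from sums_mult[OF telescope_sums[OF this], of "- ((1 - b) * (1 - inverse b) * C c b)"]
  show "(\<lambda>n. step_ratio q b c (N + n)) sums ((1 - b) * (1 - inverse b) * C c b *
    (?t N - sym_qpoch_inf q c / sym_qpoch_inf q b))"
    by (simp add: step_ratio_telescope[OF assms(2-5)] add.commute algebra_simps)
qed

section \<open>Divided differences in the variable b + 1/b\<close>

text \<open>For distinct nodes x_i = b_i + 1/b_i this is the classical divided difference of the
  values g(b_i), because C(z, y) is the reciprocal of the difference of the nodes of z and
  y.\<close>

definition divided_difference ::
  "nat \<Rightarrow> (nat \<Rightarrow> complex) \<Rightarrow> (complex \<Rightarrow> complex) \<Rightarrow> complex" where
  "divided_difference k b g = (\<Sum>i=1..k. A k i b * g (b i))"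

text \<open>The three cases in the recursion for \<open>A\<close> merge into one rule: the term i =
  k + 1 comes only from the updated list, the term i = k only from the original one, and the others
  from both.\<close>

lemma divided_difference_Suc:
  assumes "k \<ge> 1"
  shows "divided_difference (Suc k) b g = C (b (Suc k)) (b k) *
    (divided_difference k (b(k := b (Suc k))) g - divided_difference k b g)"
proof -
  obtain n where k: "k = Suc n" using assms by (cases k) auto
  let ?c = "C (b (Suc k)) (b k)" and ?b = "b(k := b (Suc k))"
  have low: "A (Suc k) i b * g (b i) = ?c * (A k i ?b * g (?b i) - A k i b * g (b i))"
    if "i \<in> {1..n}" for i
    using that by (simp add: k algebra_simps)
  have "divided_difference (Suc k) b g =
      (\<Sum>i=1..n. A (Suc k) i b * g (b i)) + A (Suc k) k b * g (b k)
        + A (Suc k) (Suc k) b * g (b (Suc k))"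
    by (simp add: divided_difference_def k)
  also have "(\<Sum>i=1..n. A (Suc k) i b * g (b i)) =
      (\<Sum>i=1..n. ?c * (A k i ?b * g (?b i) - A k i b * g (b i)))"
    by (intro sum.cong refl low)
  also have "\<dots> + A (Suc k) k b * g (b k) + A (Suc k) (Suc k) b * g (b (Suc k)) =
      (\<Sum>i=1..n. ?c * (A k i ?b * g (?b i) - A k i b * g (b i)))
        - ?c * (A k k b * g (b k)) + ?c * (A k k ?b * g (b (Suc k)))"
    by (simp add: k)
  also have "\<dots> = ?c * (divided_difference k ?b g - divided_difference k b g)"
    by (simp add: divided_difference_def k sum_subtractf ring_distribs
        flip: sum_distrib_left)
  finally show ?thesis .
qed

section \<open>How the summand changes with its last index and its last parameter\<close>

text \<open>The new index enters only the last partial sum. Passing from k to k + 1 raises every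
  weight k - i by one, so the exponent grows by exactly that partial sum.\<close>

lemma multi_term_Suc:
  assumes "k \<ge> 1"
  shows "multi_term q (Suc k) b (m(k := n)) =
    multi_term q k b m * step_ratio q (b k) (b (Suc k)) ((\<Sum>i=1..<k. m i) + n)"
proof -
  let ?m = "m(k := n)" and ?N = "\<Sum>i=1..<k. m i"
  have part: "(\<Sum>i=1..j. ?m i) = (\<Sum>i=1..j. m i)" if "j \<in> {1..<k}" for j
    using that by (intro sum.cong) auto
  have "{1..k} = insert k {1..<k}" using assms by auto
  then have last: "(\<Sum>i=1..k. ?m i) = ?N + n"
    by (simp add: add.commute)
  have "(\<Sum>i=1..<Suc k. (Suc k - i) * ?m i) = (\<Sum>i=1..<k. (Suc k - i) * m i) + n"
    using assms by (simp add: sum.atLeastLessThan_Suc)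
  also have "(\<Sum>i=1..<k. (Suc k - i) * m i) = (\<Sum>i=1..<k. (k - i) * m i + m i)"
    by (intro sum.cong) (auto simp: Suc_diff_le)
  finally have expo: "(\<Sum>i=1..<Suc k. (Suc k - i) * ?m i) =
      (\<Sum>i=1..<k. (k - i) * m i) + (?N + n)"
    by (simp add: sum.distrib)
  have pr: "(\<Prod>j=1..<Suc k. h j (\<Sum>i=1..j. ?m i)) =
      (\<Prod>j=1..<k. h j (\<Sum>i=1..j. m i)) * h k (?N + n)" for h :: "nat \<Rightarrow> nat \<Rightarrow> complex"
    using assms part last by (simp add: prod.atLeastLessThan_Suc)
  show ?thesis
    unfolding multi_term_def step_ratio_def expo power_add
      pr[of "\<lambda>j. sym_qpoch q (b (j + 1))"] pr[of "\<lambda>j. qpochs [q * b j, q * inverse (b j)] q"]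
    by simp
qed

text \<open>The parameter b_k occurs only in the last numerator factor, as the denominators stop at
  b_(k-1). This identifies the lower end of the telescoped sum with the summand for the altered
  parameters.\<close>

lemma multi_term_update_last:
  assumes "k \<ge> 1" "\<And>n. sym_qpoch q (b k) n \<noteq> 0"
  shows "multi_term q k (b(k := c)) m = multi_term q k b m *
    (sym_qpoch q c (\<Sum>i=1..<k. m i) / sym_qpoch q (b k) (\<Sum>i=1..<k. m i))"
proof (cases "k = 1")
  \<comment> \<open>The partial sum is empty here, so both products on the right have length 0 and
    equal 1.\<close>
  case True
  then show ?thesis by (simp add: multi_term_def qpochs_def qpoch_def)
next
  case False
  then obtain n where k: "k = Suc n" and n: "n \<ge> 1" using assms(1) by (cases k) auto
  have N: "(\<Sum>i=1..<Suc n. m i) = (\<Sum>i=1..n. m i)"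
    by (simp add: atLeastLessThanSuc_atLeastAtMost)
  have init: "(\<Prod>j=1..<n. sym_qpoch q ((b(k := c)) (j + 1)) (\<Sum>i=1..j. m i)) =
      (\<Prod>j=1..<n. sym_qpoch q (b (j + 1)) (\<Sum>i=1..j. m i))"
    by (intro prod.cong) (auto simp: k)
  have num: "(\<Prod>j=1..<k. sym_qpoch q ((b(k := c)) (j + 1)) (\<Sum>i=1..j. m i)) =
      (\<Prod>j=1..<k. sym_qpoch q (b (j + 1)) (\<Sum>i=1..j. m i)) *
      (sym_qpoch q c (\<Sum>i=1..<k. m i) / sym_qpoch q (b k) (\<Sum>i=1..<k. m i))"
    using init assms(2) unfolding k prod.atLeastLessThan_Suc[OF n] N by simp
  have den: "(\<Prod>j=1..<k. qpochs [q * (b(k := c)) j, q * inverse ((b(k := c)) j)] q (\<Sum>i=1..j. m i)) =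
      (\<Prod>j=1..<k. qpochs [q * b j, q * inverse (b j)] q (\<Sum>i=1..j. m i))"
    by (intro prod.cong) auto
  show ?thesis
    unfolding multi_term_def num den by (simp add: mult_ac)
qed

section \<open>Summability and evaluation of the multiple sum\<close>

lemma bij_betw_PiE_Suc:
  assumes "k \<ge> 1"
  shows "bij_betw (\<lambda>(m, n). m(k := n)) (({1..<k} \<rightarrow>\<^sub>E UNIV) \<times> UNIV) ({1..<Suc k} \<rightarrow>\<^sub>E UNIV)"
proof (rule bij_betwI[where g = "\<lambda>m. (restrict m {1..<k}, m k)"])
  show "(\<lambda>(m, n). m(k := n)) \<in> ({1..<k} \<rightarrow>\<^sub>E UNIV) \<times> UNIV \<rightarrow> {1..<Suc k} \<rightarrow>\<^sub>E UNIV"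
    using assms by (auto simp: PiE_iff extensional_def)
qed (use assms in \<open>auto simp: PiE_iff extensional_def restrict_def fun_eq_iff\<close>)

text \<open>The last factor is dominated by K |q|^n uniformly in the outer indices, so induction
  compares the family with a product of two summable ones.\<close>

lemma multi_term_abs_summable:
  assumes "norm q < 1" "k \<ge> 1"
    and "\<And>i. i \<in> {1..<k} \<Longrightarrow> b i \<noteq> 0"
    and "\<And>i. i \<in> {1..<k} \<Longrightarrow> b i \<notin> range (\<lambda>j::int. q powi j)"
  shows "(\<lambda>m. norm (multi_term q k b m)) summable_on ({1..<k} \<rightarrow>\<^sub>E UNIV)"
  using assms(2-)
proof (induction k rule: dec_induct)
  case base
  then show ?case by simp
next
  case (step k)
  let ?S = "{1..<k} \<rightarrow>\<^sub>E (UNIV :: nat set)"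
  obtain K where K: "\<And>n. norm (step_ratio q (b k) (b (Suc k)) n) \<le> K * norm q ^ n"
    using step_ratio_bound[OF assms(1), of "b k"] step by auto
  have "0 \<le> norm (step_ratio q (b k) (b (Suc k)) 0)" by (rule norm_ge_zero)
  also have "\<dots> \<le> K" using K[of 0] by simp
  finally have K0: "K \<ge> 0" .
  have bound: "norm (multi_term q (Suc k) b (m(k := n))) \<le> norm (multi_term q k b m) * (K * norm q ^ n)"
    for m n
  proof -
    have "norm (step_ratio q (b k) (b (Suc k)) ((\<Sum>i=1..<k. m i) + n))
        \<le> K * norm q ^ ((\<Sum>i=1..<k. m i) + n)"
      by (rule K)
    also have "\<dots> \<le> K * norm q ^ n"
      \<comment> \<open>As |q| < 1, dropping the outer indices from the exponent only enlarges the
        bound.\<close>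
      using assms(1) K0 by (intro mult_left_mono power_decreasing) auto
    finally show ?thesis
      using step by (simp add: multi_term_Suc norm_mult mult_left_mono)
  qed
  have geo: "((\<lambda>n. K * norm q ^ n) has_sum (K * (1 / (1 - norm q)))) UNIV"
    using assms(1) by (intro norm_summable_imp_has_sum sums_mult geometric_sums)
      (auto simp: abs_mult intro!: summable_mult summable_geometric)
  have IH: "(\<lambda>m. norm (multi_term q k b m)) summable_on ?S"
    using step by (intro step.IH) auto
  have "(\<lambda>(m, n). norm (multi_term q k b m) * (K * norm q ^ n)) summable_on ?S \<times> UNIV"
  proof (rule summable_on_SigmaI)
    show "((\<lambda>n. case (m, n) of (m, n) \<Rightarrow> norm (multi_term q k b m) * (K * norm q ^ n))
        has_sum (norm (multi_term q k b m) * (K * (1 / (1 - norm q))))) UNIV" for m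
      using has_sum_cmult_right[OF geo] by simp
    show "(\<lambda>m. norm (multi_term q k b m) * (K * (1 / (1 - norm q)))) summable_on ?S"
      using IH by (rule summable_on_cmult_left)
  qed (use K0 in auto)
  then have "(\<lambda>x. norm (multi_term q (Suc k) b (case x of (m, n) \<Rightarrow> m(k := n)))) summable_on ?S \<times> UNIV"
    by (rule Infinite_Sum.abs_summable_on_comparison_test') (use bound in auto)
  then show ?case
    using summable_on_reindex_bij_betw[OF bij_betw_PiE_Suc,
        of k "\<lambda>m. norm (multi_term q (Suc k) b m)"] step by simp
qed

text \<open>The induction must vary \<open>b\<close>: its step uses the hypothesis for b_1, ..., b_k
  and again with b_k replaced by b_(k+1). Putting the factor i = k into the infinite product leaves
  a finite product that this replacement does not change.\<close>

lemma multi_term_has_sum: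
  assumes "norm q < 1" "k \<ge> 1"
    and "\<And>i. i \<in> {1..k} \<Longrightarrow> b i \<noteq> 0"
    and "\<And>i. i \<in> {1..k} \<Longrightarrow> b i \<notin> range (\<lambda>j::int. q powi j)"
    and "inj_on (\<lambda>i. b i + inverse (b i)) {1..k}"
  shows "(multi_term q k b has_sum
      (sym_qpoch_inf q (b k) * (\<Prod>i=1..<k. (1 - b i) * (1 - inverse (b i)))
        * divided_difference k b (\<lambda>c. 1 / sym_qpoch_inf q c))) ({1..<k} \<rightarrow>\<^sub>E UNIV)"
  using assms(2-)
proof (induction k arbitrary: b rule: dec_induct)
  case base
  have "sym_qpoch_inf q (b 1) \<noteq> 0"
    using base assms(1) by (intro sym_qpoch_inf_nonzero) auto
  moreover have "multi_term q 1 b = (\<lambda>_. 1)" by (simp add: multi_term_def fun_eq_iff)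
  ultimately show ?case
    \<comment> \<open>For k = 1 the only index function is the one that is \<open>undefined\<close>
      everywhere.\<close>
    using has_sum_finite[of "{\<lambda>x. undefined}" "\<lambda>_. 1 :: complex"]
    by (simp add: divided_difference_def)
next
  case (step k)
  let ?S = "{1..<k} \<rightarrow>\<^sub>E (UNIV :: nat set)" and ?g = "\<lambda>c. 1 / sym_qpoch_inf q c"
  let ?u = "\<lambda>i. (1 - b i) * (1 - inverse (b i))"
  define c where "c = b (Suc k)"
  define U where "U = (\<Prod>i=1..<k. ?u i)"
  define b' where "b' = b(k := c)"
  define F G where "F = sym_qpoch_inf q (b k)" and "G = sym_qpoch_inf q c"
  define D D' where "D = divided_difference k b ?g" and "D' = divided_difference k b' ?g"
  have bk: "b k \<noteq> 0" "b k \<notin> range (\<lambda>j::int. q powi j)" and c0: "c \<noteq> 0"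
    using step by (auto simp: c_def)
  have neq: "b k + inverse (b k) \<noteq> c + inverse c"
    using inj_onD[OF step.prems(3), of k "Suc k"] step.hyps by (auto simp: c_def)
  have F0: "F \<noteq> 0" unfolding F_def by (intro sym_qpoch_inf_nonzero bk assms(1))
  have inj': "inj_on (\<lambda>i. b' i + inverse (b' i)) {1..k}"
  proof (rule inj_onI)
    fix i j assume ij: "i \<in> {1..k}" "j \<in> {1..k}" "b' i + inverse (b' i) = b' j + inverse (b' j)"
    \<comment> \<open>The list b' is b read through the injection that sends k to k + 1, so its
      nodes stay distinct.\<close>
    let ?s = "\<lambda>i. if i = k then Suc k else i"
    have "b' l = b (?s l)" for l by (simp add: b'_def c_def)
    with ij have "?s i = ?s j"
      by (intro inj_onD[OF step.prems(3)]) auto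
    with ij show "i = j" by (auto split: if_splits)
  qed
  have IH: "(multi_term q k b has_sum F * U * D) ?S"
    unfolding F_def U_def D_def
    using step.prems by (intro step.IH inj_on_subset[OF step.prems(3)]) auto
  have U': "(\<Prod>i=1..<k. (1 - b' i) * (1 - inverse (b' i))) = U"
    unfolding U_def by (intro prod.cong) (auto simp: b'_def)
  have IH': "(multi_term q k b' has_sum G * U * D') ?S"
  proof -
    have "b' i \<noteq> 0" "b' i \<notin> range (\<lambda>j::int. q powi j)" if "i \<in> {1..k}" for i
      using that step.prems(1)[of i] step.prems(2)[of i]
        step.prems(1)[of "Suc k"] step.prems(2)[of "Suc k"]
      by (simp_all add: b'_def c_def)
    note IH_b' = step.IH[OF this inj']
    have "b' k = c" by (simp add: b'_def)
    with IH_b' show ?thesis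
      by (simp only: U' D'_def G_def)
  qed
  \<comment> \<open>The lower end turns the summand for b into the one for b', and the limit at
    infinity contributes the constant G / F.\<close>
  have inner: "((\<lambda>n. multi_term q (Suc k) b (m(k := n))) has_sum
      ?u k * C c (b k) * (multi_term q k b' m - G / F * multi_term q k b m)) UNIV" for m
  proof -
    let ?N = "\<Sum>i=1..<k. m i"
    have tele: "((\<lambda>n. multi_term q k b m * step_ratio q (b k) c (?N + n)) has_sum
      multi_term q k b m * (?u k * C c (b k) *
        (sym_qpoch q c ?N / sym_qpoch q (b k) ?N - G / F))) UNIV"
      unfolding F_def G_def
      by (intro has_sum_cmult_right step_ratio_tail_has_sum assms(1) bk c0 neq)
    have upd: "multi_term q k b' m =
        multi_term q k b m * (sym_qpoch q c ?N / sym_qpoch q (b k) ?N)"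
      unfolding b'_def using step.hyps sym_qpoch_nonzero[OF bk] by (intro multi_term_update_last) auto
    have swap: "X * (v * (r - H)) = v * (X * r - H * X)" for X v r H :: complex
      by (simp add: algebra_simps)
    show ?thesis
      using tele unfolding swap[of "multi_term q k b m"] upd multi_term_Suc[OF step.hyps(1)] c_def .
  qed
  have outer: "((\<lambda>m. ?u k * C c (b k) * (multi_term q k b' m - G / F * multi_term q k b m))
      has_sum ?u k * C c (b k) * (G * U * D' - G / F * (F * U * D))) ?S"
  proof (rule has_sum_cmult_right)
    have "((\<lambda>m. - (G / F) * multi_term q k b m) has_sum - (G / F) * (F * U * D)) ?S"
      by (rule has_sum_cmult_right[OF IH])
    from has_sum_add[OF IH' this]
    show "((\<lambda>m. multi_term q k b' m - G / F * multi_term q k b m)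
        has_sum (G * U * D' - G / F * (F * U * D))) ?S"
      by simp
  qed
  have bij: "bij_betw (\<lambda>(m, n). m(k := n)) (?S \<times> UNIV) ({1..<Suc k} \<rightarrow>\<^sub>E UNIV)"
    using step.hyps by (intro bij_betw_PiE_Suc)
  \<comment> \<open>Joint summability allows the iterated sums to be merged into one sum over
    pairs.\<close>
  have "multi_term q (Suc k) b summable_on ({1..<Suc k} \<rightarrow>\<^sub>E UNIV)"
    using step.prems by (intro abs_summable_summable[OF multi_term_abs_summable] assms(1)) auto
  then have "(\<lambda>x. multi_term q (Suc k) b (case x of (m, n) \<Rightarrow> m(k := n))) summable_on ?S \<times> UNIV"
    using summable_on_reindex_bij_betw[OF bij, of "multi_term q (Suc k) b"] by simp
  then have "((\<lambda>x. multi_term q (Suc k) b (case x of (m, n) \<Rightarrow> m(k := n))) has_sum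
      ?u k * C c (b k) * (G * U * D' - G / F * (F * U * D))) (?S \<times> UNIV)"
    by (rule has_sum_SigmaI[OF _ outer, rotated]) (simp only: prod.case inner)
  then have total: "(multi_term q (Suc k) b has_sum
      ?u k * C c (b k) * (G * U * D' - G / F * (F * U * D))) ({1..<Suc k} \<rightarrow>\<^sub>E UNIV)"
    using has_sum_reindex_bij_betw[OF bij, of "multi_term q (Suc k) b"] by simp
  have dd: "divided_difference (Suc k) b ?g = C c (b k) * (D' - D)"
    using step.hyps by (simp add: divided_difference_Suc c_def b'_def D_def D'_def)
  have prd: "(\<Prod>i=1..<Suc k. ?u i) = U * ?u k"
    using step.hyps by (simp add: U_def prod.atLeastLessThan_Suc)
  \<comment> \<open>Cancelling F leaves G, the infinite product at b_(k+1), as the common prefactor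
    of D' - D.\<close>
  have val: "?u k * C c (b k) * (G * U * D' - G / F * (F * U * D))
      = G * (U * ?u k) * (C c (b k) * (D' - D))"
  proof -
    have "v * e * (G * U * D' - G / F * (F * U * D)) = G * (U * v) * (e * (D' - D))"
      for v e :: complex
      using F0 by (simp add: field_simps)
    then show ?thesis .
  qed
  have "sym_qpoch_inf q (b (Suc k)) = G" by (simp only: G_def c_def)
  with total show ?case unfolding val dd prd by (simp only:)
qed

theorem theorem1p1:
  fixes q :: complex and k :: nat and b :: "nat \<Rightarrow> complex"
  assumes "norm q < 1"
    and "k \<ge> 1"
    and "\<And>i. i \<in> {1..k} \<Longrightarrow> b i \<noteq> 0"
    and "\<And>i. i \<in> {1..k} \<Longrightarrow> b i \<notin> range (\<lambda>j::int. q powi j)"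
    and "inj_on (\<lambda>i. b i + inverse (b i)) {1..k}"
  shows "(multi_term q k b has_sum
      (qpochs_inf [q * b k, q / b k] q * (\<Prod>i=1..k. (1 - b i) * (1 - inverse (b i)))
        * (\<Sum>i=1..k. A k i b / qpochs_inf [b i, inverse (b i)] q)))
    ({1..<k} \<rightarrow>\<^sub>E UNIV)"
proof -
  let ?P = "\<Prod>i=1..<k. (1 - b i) * (1 - inverse (b i))"
  let ?D = "\<Sum>i=1..k. A k i b / qpochs_inf [b i, inverse (b i)] q"
  have "{1..k} = insert k {1..<k}" using assms(2) by auto
  then have "(\<Prod>i=1..k. (1 - b i) * (1 - inverse (b i))) =
      (1 - b k) * (1 - inverse (b k)) * ?P"
    by simp
  \<comment> \<open>The split-off factor (1 - b_k)(1 - 1/b_k) completes (q b_k, q/b_k; q) to the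
    infinite product (b_k, 1/b_k; q).\<close>
  then have "qpochs_inf [q * b k, q / b k] q * (\<Prod>i=1..k. (1 - b i) * (1 - inverse (b i))) =
      sym_qpoch_inf q (b k) * ?P"
    unfolding sym_qpoch_inf_shift[OF assms(1), of "b k"] by (simp only: mult_ac)
  moreover have "divided_difference k b (\<lambda>c. 1 / sym_qpoch_inf q c) = ?D"
    by (simp add: divided_difference_def)
  ultimately show ?thesis
    using multi_term_has_sum[OF assms] by (simp only:)
qed

end
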